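(* Let $\nu>0$, $\lambda>0$, $\alpha\ge 0$. Let $f\in C(\mathbb R,\ell_2)$ be almost periodic. Let $F\in C(\mathbb R,\mathbb R)$ be Lipschitz continuous on bounded sets with $F(0)=0$, and suppose that $$(x_1-x_2)(F(x_1)-F(x_2))\le -\alpha|x_1-x_2|^2\qquad\text{for all }x_1,x_2\in\mathbb R.$$ Then the equation $$u'=\nu\Lambda u-\lambda u+\widetilde F(u)+f(t)$$ in $\ell_2$ has a unique almost periodic solution, i.e. there exists exactly one almost periodic function $u\in C(\mathbb R,\ell_2)$ that satisfies the equation for all $t\in\mathbb R$.
   Context: $\ell_2$ is the Hilbert space of real two-sided square-summable sequences $(\xi_i)_{i\in\mathbb Z}$ with $\langle\xi,\eta\rangle=\sum_{i\in\mathbb Z}\xi_i\eta_i$ and norm $\|\xi\|^2=\langle\xi,\xi\rangle$. The discrete Laplacian $\Lambda:\ell_2\to\ell_2$ is $(\Lambda u)_i=u_{i-1}-2u_i+u_{i+1}$. The Nemytskii operator $\widetilde F:\ell_2\to\ell_2$ is $\widetilde F(\xi)_i=F(\xi_i)$ (it is well defined because $F$ is locally Lipschitz and $F(0)=0$). The equation is the abstract form of the lattice system $u_i'=\nu(u_{i-1}-2u_i+u_{i+1})-\lambda u_i+F(u_i)+f_i(t)$, $i\in\mathbb Z$, where $f(t)=(f_i(t))_{i\in\mathbb Z}$. A set $A\subset\mathbb R$ is relatively dense if there is $l>0$ with $A\cap[a,a+l]\neq\emptyset$ for all $a\in\mathbb R$. A function $f\in C(\mathbb R,\ell_2)$ is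 almost periodic if for every $\varepsilon>0$ the set $\{\tau\in\mathbb R:\ \|f(t+\tau)-f(t)\|<\varepsilon\ \text{for all }t\in\mathbb R\}$ is relatively dense. *)

theory Defs
  imports "HOL-Analysis.Analysis"
begin

lemma square_summable_mult:
  fixes x y :: "'i \<Rightarrow> real"
  assumes "(\<lambda>i. (x i)\<^sup>2) summable_on A" "(\<lambda>i. (y i)\<^sup>2) summable_on A"
  shows "(\<lambda>i. x i * y i) summable_on A"
proof -
  have "(\<lambda>i. norm (x i * x i)) summable_on A" "(\<lambda>i. norm (y i * y i)) summable_on A"
    using assms by (simp_all add: power2_eq_square)
  then show ?thesis
    by (rule abs_summable_summable[OF abs_summable_product])
qed

lemma square_summable_add:
  fixes x y :: "'i \<Rightarrow> real"
  assumes "(\<lambda>i. (x i)\<^sup>2) summable_on A" "(\<lambda>i. (y i)\<^sup>2) summable_on A"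
  shows "(\<lambda>i. (x i + y i)\<^sup>2) summable_on A"
proof -
  have "(\<lambda>i. ((x i)\<^sup>2 + (y i)\<^sup>2) + 2 * (x i * y i)) summable_on A"
    by (intro summable_on_add summable_on_cmult_right assms square_summable_mult)
  moreover have "(x i + y i)\<^sup>2 = ((x i)\<^sup>2 + (y i)\<^sup>2) + 2 * (x i * y i)" for i
    by (simp add: power2_sum)
  ultimately show ?thesis by simp
qed

lemma square_summable_scale:
  fixes x :: "'i \<Rightarrow> real"
  assumes "(\<lambda>i. (x i)\<^sup>2) summable_on A"
  shows "(\<lambda>i. (c * x i)\<^sup>2) summable_on A"
  using assms by (simp add: power_mult_distrib summable_on_cmult_right)

lemma square_summable_diff:
  fixes x y :: "'i \<Rightarrow> real"
  assumes "(\<lambda>i. (x i)\<^sup>2) summable_on A" "(\<lambda>i. (y i)\<^sup>2) summable_on A"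
  shows "(\<lambda>i. (x i - y i)\<^sup>2) summable_on A"
  using square_summable_add[OF assms(1) square_summable_scale[OF assms(2), of "-1"]] by simp

lemma square_summable_shift:
  fixes x :: "int \<Rightarrow> real"
  assumes "(\<lambda>i. (x i)\<^sup>2) summable_on UNIV"
  shows "(\<lambda>i. (x (i + k))\<^sup>2) summable_on UNIV"
proof -
  have "bij_betw (\<lambda>i. i + k) UNIV UNIV"
    by (rule bij_betwI[of _ _ _ "\<lambda>i. i - k"]) auto
  from summable_on_reindex_bij_betw[OF this, of "\<lambda>i. (x i)\<^sup>2"] assms show ?thesis by simp
qed

typedef l2 = "{x :: int \<Rightarrow> real. (\<lambda>i. (x i)\<^sup>2) summable_on UNIV}"
  morphisms l2_nth Abs_l2
  by (rule exI[of _ "\<lambda>_. 0"]) simp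

setup_lifting type_definition_l2

lemma l2_nth_square_summable: "(\<lambda>i. (l2_nth x i)\<^sup>2) summable_on UNIV"
  using l2_nth[of x] by simp

lemma l2_eqI: "(\<And>i. l2_nth x i = l2_nth y i) \<Longrightarrow> x = y"
  by transfer auto

instantiation l2 :: real_vector
begin

lift_definition zero_l2 :: l2 is "\<lambda>_. 0" by simp
lift_definition plus_l2 :: "l2 \<Rightarrow> l2 \<Rightarrow> l2" is "\<lambda>x y i. x i + y i"
  by (rule square_summable_add)
lift_definition minus_l2 :: "l2 \<Rightarrow> l2 \<Rightarrow> l2" is "\<lambda>x y i. x i - y i"
  by (rule square_summable_diff)
lift_definition uminus_l2 :: "l2 \<Rightarrow> l2" is "\<lambda>x i. - x i" by simp
lift_definition scaleR_l2 :: "real \<Rightarrow> l2 \<Rightarrow> l2" is "\<lambda>c x i. c * x i"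
  by (rule square_summable_scale)

instance
  by standard (transfer; simp add: algebra_simps fun_eq_iff)+

end

lemma l2_nth_simps [simp]:
  "l2_nth 0 i = 0"
  "l2_nth (x + y) i = l2_nth x i + l2_nth y i"
  "l2_nth (x - y) i = l2_nth x i - l2_nth y i"
  "l2_nth (- x) i = - l2_nth x i"
  "l2_nth (c *\<^sub>R x) i = c * l2_nth x i"
  by (transfer; simp)+

instantiation l2 :: real_inner
begin

definition inner_l2 :: "l2 \<Rightarrow> l2 \<Rightarrow> real"
  where "inner_l2 x y = (\<Sum>\<^sub>\<infinity>i. l2_nth x i * l2_nth y i)"
definition norm_l2 :: "l2 \<Rightarrow> real"
  where "norm_l2 x = sqrt (inner x x)"
definition sgn_l2 :: "l2 \<Rightarrow> l2"
  where "sgn_l2 x = x /\<^sub>R norm x"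
definition dist_l2 :: "l2 \<Rightarrow> l2 \<Rightarrow> real"
  where "dist_l2 x y = norm (x - y)"
definition [code del]:
  "(uniformity :: (l2 \<times> l2) filter) = (INF e\<in>{0 <..}. principal {(x, y). dist x y < e})"
definition open_l2 :: "l2 set \<Rightarrow> bool"
  where "open_l2 U \<longleftrightarrow> (\<forall>x\<in>U. eventually (\<lambda>(x', y). x' = x \<longrightarrow> y \<in> U) uniformity)"

instance
proof
  fix x y z :: l2 and r :: real and U :: "l2 set"
  note sm = square_summable_mult[OF l2_nth_square_summable l2_nth_square_summable]
  show "sgn x = x /\<^sub>R norm x" by (rule sgn_l2_def)
  show "dist x y = norm (x - y)" by (rule dist_l2_def)
  show "(uniformity :: (l2 \<times> l2) filter) = (INF e\<in>{0 <..}. principal {(x, y). dist x y < e})"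
    by (rule uniformity_l2_def)
  show "open U \<longleftrightarrow> (\<forall>x\<in>U. eventually (\<lambda>(x', y). x' = x \<longrightarrow> y \<in> U) uniformity)"
    by (rule open_l2_def)
  show "inner x y = inner y x"
    by (simp add: inner_l2_def mult.commute)
  show "inner (x + y) z = inner x z + inner y z"
    by (simp add: inner_l2_def distrib_right infsum_add sm)
  show "inner (r *\<^sub>R x) y = r * inner x y"
    by (simp add: inner_l2_def mult.assoc infsum_cmult_right sm)
  show "0 \<le> inner x x"
    by (simp add: inner_l2_def infsum_nonneg)
  show "inner x x = 0 \<longleftrightarrow> x = 0"
  proof
    assume "inner x x = 0"
    then have "(\<Sum>\<^sub>\<infinity>i. l2_nth x i * l2_nth x i) \<le> 0"
      by (simp add: inner_l2_def)
    then have "l2_nth x i * l2_nth x i = 0" for i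
      by (rule nonneg_infsum_le_0D) (auto intro: sm)
    then show "x = 0" by (intro l2_eqI) simp
  qed (simp add: inner_l2_def)
  show "norm x = sqrt (inner x x)" by (rule norm_l2_def)
qed

end

lemma l2_norm_square: "(norm x)\<^sup>2 = (\<Sum>\<^sub>\<infinity>i. (l2_nth x i)\<^sup>2)"
  by (simp add: power2_norm_eq_inner inner_l2_def flip: power2_eq_square)

lemma sum_square_le_l2_norm: "finite I \<Longrightarrow> (\<Sum>i\<in>I. (l2_nth x i)\<^sup>2) \<le> (norm x)\<^sup>2"
  unfolding l2_norm_square by (rule finite_sum_le_infsum) (auto intro: l2_nth_square_summable)

lemma abs_l2_nth_le_norm: "\<bar>l2_nth x i\<bar> \<le> norm x"
  using sum_square_le_l2_norm[of "{i}" x] abs_le_square_iff[of "l2_nth x i" "norm x"] by simp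

instance l2 :: complete_space
proof
  fix X :: "nat \<Rightarrow> l2"
  assume X: "Cauchy X"
  have "Cauchy (\<lambda>n. l2_nth (X n) i)" for i
  proof (rule metric_CauchyI)
    fix e :: real assume "e > 0"
    with X obtain M where "\<forall>m\<ge>M. \<forall>n\<ge>M. dist (X m) (X n) < e"
      using metric_CauchyD by blast
    moreover have "dist (l2_nth (X m) i) (l2_nth (X n) i) \<le> dist (X m) (X n)" for m n
      using abs_l2_nth_le_norm[of "X m - X n" i] by (simp add: dist_norm)
    ultimately show "\<exists>M. \<forall>m\<ge>M. \<forall>n\<ge>M. dist (l2_nth (X m) i) (l2_nth (X n) i) < e"
      by (meson le_less_trans)
  qed
  then have "\<exists>l. (\<lambda>n. l2_nth (X n) i) \<longlonglongrightarrow> l" for i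
    using Cauchy_convergent_iff convergent_def by blast
  then obtain y where y: "\<And>i. (\<lambda>n. l2_nth (X n) i) \<longlonglongrightarrow> y i"
    by metis
  have tail: "\<exists>M. \<forall>m\<ge>M. \<forall>I. finite I \<longrightarrow> (\<Sum>i\<in>I. (l2_nth (X m) i - y i)\<^sup>2) \<le> e\<^sup>2"
    if "e > 0" for e :: real
  proof -
    from X that obtain M where M: "\<And>m n. m \<ge> M \<Longrightarrow> n \<ge> M \<Longrightarrow> dist (X m) (X n) < e"
      using metric_CauchyD by blast
    have "(\<Sum>i\<in>I. (l2_nth (X m) i - y i)\<^sup>2) \<le> e\<^sup>2" if "m \<ge> M" "finite I" for m I
    proof (rule LIMSEQ_le_const2)
      show "(\<lambda>n. \<Sum>i\<in>I. (l2_nth (X m) i - l2_nth (X n) i)\<^sup>2)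
              \<longlonglongrightarrow> (\<Sum>i\<in>I. (l2_nth (X m) i - y i)\<^sup>2)"
        by (intro tendsto_intros y)
      have "(\<Sum>i\<in>I. (l2_nth (X m) i - l2_nth (X n) i)\<^sup>2) \<le> e\<^sup>2" if "n \<ge> M" for n
      proof -
        have "(\<Sum>i\<in>I. (l2_nth (X m) i - l2_nth (X n) i)\<^sup>2) \<le> (norm (X m - X n))\<^sup>2"
          using sum_square_le_l2_norm[OF \<open>finite I\<close>, of "X m - X n"] by simp
        also have "\<dots> \<le> e\<^sup>2"
          using M[OF \<open>m \<ge> M\<close> that] by (intro power_mono) (auto simp: dist_norm)
        finally show ?thesis .
      qed
      then show "\<exists>N. \<forall>n\<ge>N. (\<Sum>i\<in>I. (l2_nth (X m) i - l2_nth (X n) i)\<^sup>2) \<le> e\<^sup>2"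
        by blast
    qed
    then show ?thesis by blast
  qed
  obtain m where m: "\<And>I. finite I \<Longrightarrow> (\<Sum>i\<in>I. (l2_nth (X m) i - y i)\<^sup>2) \<le> 1"
    using tail[of 1] by auto
  have "(\<lambda>i. (l2_nth (X m) i - y i)\<^sup>2) summable_on UNIV"
    by (rule nonneg_bdd_above_summable_on) (auto simp: bdd_above_def intro!: exI[of _ 1] m)
  from square_summable_diff[OF l2_nth_square_summable[of "X m"] this]
  have "(\<lambda>i. (y i)\<^sup>2) summable_on UNIV" by simp
  then have Y: "l2_nth (Abs_l2 y) = y" by (simp add: Abs_l2_inverse)
  have "X \<longlonglongrightarrow> Abs_l2 y"
  proof (rule metric_LIMSEQ_I)
    fix e :: real assume "e > 0"
    then obtain M where
      M: "\<And>m I. m \<ge> M \<Longrightarrow> finite I \<Longrightarrow> (\<Sum>i\<in>I. (l2_nth (X m) i - y i)\<^sup>2) \<le> (e / 2)\<^sup>2"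
      using tail[of "e / 2"] by auto
    have "dist (X n) (Abs_l2 y) < e" if "n \<ge> M" for n
    proof -
      have "(norm (X n - Abs_l2 y))\<^sup>2 \<le> (e / 2)\<^sup>2"
        unfolding l2_norm_square
        by (rule infsum_le_finite_sums[OF l2_nth_square_summable]) (use M[OF that] Y in simp)
      then have "norm (X n - Abs_l2 y) \<le> e / 2"
        using \<open>e > 0\<close> by (auto intro: power2_le_imp_le)
      then show ?thesis using \<open>e > 0\<close> by (simp add: dist_norm)
    qed
    then show "\<exists>N. \<forall>n\<ge>N. dist (X n) (Abs_l2 y) < e" by blast
  qed
  then show "convergent X" by (auto simp: convergent_def)
qed

lift_definition discrete_laplacian :: "l2 \<Rightarrow> l2"
  is "\<lambda>u i. u (i - 1) - 2 * u i + u (i + 1)"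
proof -
  fix u :: "int \<Rightarrow> real"
  assume u: "(\<lambda>i. (u i)\<^sup>2) summable_on UNIV"
  show "(\<lambda>i. (u (i - 1) - 2 * u i + u (i + 1))\<^sup>2) summable_on UNIV"
    using square_summable_add[OF square_summable_diff[OF square_summable_shift[OF u, of "-1"]
        square_summable_scale[OF u, of 2]] square_summable_shift[OF u, of 1]]
    by simp
qed

text \<open>The coordinatewise image of a square-summable sequence need not be square-summable for an
  arbitrary \<open>F\<close>, in which case the value below is unspecified. The lemma \<open>l2_nth_nemytskii\<close> shows
  that this does not happen if \<open>F\<close> is Lipschitz on bounded sets and \<open>F 0 = 0\<close>.\<close>

definition nemytskii :: "(real \<Rightarrow> real) \<Rightarrow> l2 \<Rightarrow> l2"
  where "nemytskii F x = Abs_l2 (\<lambda>i. F (l2_nth x i))"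

definition lipschitz_on_bounded_sets :: "('a::metric_space \<Rightarrow> 'b::metric_space) \<Rightarrow> bool"
  where "lipschitz_on_bounded_sets F \<longleftrightarrow> (\<forall>B. bounded B \<longrightarrow> (\<exists>L. L-lipschitz_on B F))"

lemma l2_nth_nemytskii:
  assumes "lipschitz_on_bounded_sets F" "F 0 = 0"
  shows "l2_nth (nemytskii F x) i = F (l2_nth x i)"
proof -
  obtain L where L: "L-lipschitz_on (cball 0 (norm x)) F"
    using assms(1) unfolding lipschitz_on_bounded_sets_def by (meson bounded_cball)
  have "(F (l2_nth x i))\<^sup>2 \<le> (L * l2_nth x i)\<^sup>2" for i
  proof -
    have "dist (F (l2_nth x i)) (F 0) \<le> L * dist (l2_nth x i) 0"
      by (rule lipschitz_onD[OF L]) (auto simp: abs_l2_nth_le_norm)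
    then have "\<bar>F (l2_nth x i)\<bar> \<le> \<bar>L * l2_nth x i\<bar>"
      using lipschitz_on_nonneg[OF L] by (simp add: assms(2) abs_mult)
    then show ?thesis by (simp add: abs_le_square_iff)
  qed
  then have "(\<lambda>i. (F (l2_nth x i))\<^sup>2) summable_on UNIV"
    by (intro summable_on_comparison_test[OF square_summable_scale[OF l2_nth_square_summable[of x], of L]])
      auto
  then show ?thesis by (simp add: nemytskii_def Abs_l2_inverse)
qed

definition relatively_dense :: "real set \<Rightarrow> bool"
  where "relatively_dense A \<longleftrightarrow> (\<exists>l>0. \<forall>a. A \<inter> {a..a + l} \<noteq> {})"

definition almost_periodic :: "(real \<Rightarrow> 'a::real_normed_vector) \<Rightarrow> bool"
  where "almost_periodic f \<longleftrightarrow> continuous_on UNIV f \<and>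
    (\<forall>\<epsilon>>0. relatively_dense {\<tau>. \<forall>t. norm (f (t + \<tau>) - f t) < \<epsilon>})"

end

theory Submission
  imports Defs
begin

text \<open>The operator \<open>A u = \<nu> \<Lambda> u - \<lambda> u + F(u)\<close> satisfies
  \<open>\<langle>A u - A v, u - v\<rangle> \<le> - \<lambda> \<parallel>u - v\<parallel>\<^sup>2\<close>, so the distance of two bounded solutions with forcings \<open>f\<close> and
  \<open>g\<close> is at most \<open>sup \<parallel>f - g\<parallel> / \<lambda>\<close> on all of \<open>\<real>\<close>: start the energy estimate at time \<open>-\<infinity>\<close>.
  Uniqueness is the case \<open>f = g\<close>; comparing a bounded solution with its translates shows that it
  inherits the almost periods of \<open>f\<close>. Bounded solutions exist because, for large \<open>\<mu>\<close>, the map that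
  sends \<open>u\<close> to the bounded solution \<open>w\<close> of \<open>w' = - \<mu> w + (\<mu> u + A u + f)\<close> contracts a ball of bounded
  continuous functions.\<close>

section \<open>Linear equations and differential inequalities on the whole real line\<close>

lemma continuous_has_antiderivative:
  fixes h :: "real \<Rightarrow> 'a::banach"
  assumes h: "continuous_on UNIV h"
  obtains E where "\<And>t. (E has_vector_derivative h t) (at t)"
proof
  \<comment> \<open>A signed integral from 0, of which one term always vanishes. On
    \<open>{-n<..<n}\<close> it differs from the integral based at \<open>-n\<close> by a constant,
    so its derivative there is \<open>h\<close>.\<close>
  define E where "E t = integral {0..t} h - integral {t..0} h" for t :: real
  note int = integrable_continuous_real[OF continuous_on_subset[OF h subset_UNIV]]
  fix t :: real
  define n :: real where "n = \<bar>t\<bar> + 1"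
  have E: "E x = integral {-n..x} h - integral {-n..0} h" if "x \<in> {-n<..<n}" for x
  proof (cases "x \<ge> 0")
    case True
    then have "integral {x..0} h = 0" by (cases "x = 0") auto
    with True show ?thesis
      using Henstock_Kurzweil_Integration.integral_combine
          [where a = "-n" and c = 0 and b = x and f = h] int that
      by (auto simp: E_def n_def algebra_simps)
  next
    case False
    then show ?thesis
      using Henstock_Kurzweil_Integration.integral_combine
          [where a = "-n" and c = x and b = 0 and f = h] int that
      by (auto simp: E_def n_def algebra_simps)
  qed
  have t: "t \<in> {-n<..<n}" by (auto simp: n_def)
  have "((\<lambda>x. integral {-n..x} h - integral {-n..0} h) has_vector_derivative h t - 0) (at t within {-n..n})"
    by (intro has_vector_derivative_diff has_vector_derivative_const integral_has_vector_derivative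
        continuous_on_subset[OF h]) (use t in auto)
  then have "((\<lambda>x. integral {-n..x} h - integral {-n..0} h) has_vector_derivative h t) (at t within {-n<..<n})"
    unfolding diff_zero by (rule has_vector_derivative_within_subset) auto
  then have "((\<lambda>x. integral {-n..x} h - integral {-n..0} h) has_vector_derivative h t) (at t)"
    using has_vector_derivative_within_open[OF t open_greaterThanLessThan] by (rule iffD1[rotated])
  then show "(E has_vector_derivative h t) (at t)"
    by (rule has_vector_derivative_transform_within_open[OF _ open_greaterThanLessThan t]) (rule E[symmetric])
qed

text \<open>Gronwall's inequality started at time -\<infinity>:
  \<open>exp (c * s) * (\<phi> s - b / c)\<close> is nonincreasing and, as \<open>\<phi>\<close> is
  bounded, tends to 0 at -\<infinity>. Hence it is nowhere positive.\<close>

lemma bounded_subsolution_le: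
  fixes \<phi> \<phi>' :: "real \<Rightarrow> real"
  assumes deriv: "\<And>t. (\<phi> has_real_derivative \<phi>' t) (at t)"
    and le: "\<And>t. \<phi>' t \<le> b - c * \<phi> t"
    and bdd: "bounded (range \<phi>)" and c: "c > 0"
  shows "\<phi> t \<le> b / c"
proof -
  define \<psi> where "\<psi> s = exp (c * s) * (\<phi> s - b / c)" for s
  have D: "(\<psi> has_real_derivative exp (c * s) * (c * \<phi> s - b + \<phi>' s)) (at s)" for s
    unfolding \<psi>_def using c
    by (auto intro!: derivative_eq_intros deriv simp: algebra_simps)
  have mono: "\<psi> t \<le> \<psi> s" if "s \<le> t" for s
  proof (rule DERIV_nonpos_imp_nonincreasing[OF that])
    fix r
    have "exp (c * r) * (c * \<phi> r - b + \<phi>' r) \<le> 0"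
      using le[of r] by (simp add: mult_le_0_iff)
    with D show "\<exists>y. (\<psi> has_real_derivative y) (at r) \<and> y \<le> 0" by blast
  qed
  have lim0: "((\<lambda>s. exp (c * s)) \<longlongrightarrow> 0) at_bot"
    by (intro filterlim_compose[OF exp_at_bot] filterlim_tendsto_pos_mult_at_bot[OF tendsto_const c]
        filterlim_ident)
  obtain B where B: "\<And>s. \<bar>\<phi> s\<bar> \<le> B" using bdd by (auto simp: bounded_iff)
  have "(\<psi> \<longlongrightarrow> 0) at_bot"
    unfolding \<psi>_def
  proof (rule lim_null_mult_right_bounded[OF lim0])
    show "\<forall>\<^sub>F s in at_bot. norm (\<phi> s - b / c) \<le> B + \<bar>b / c\<bar>"
      using B by (intro always_eventually allI) (metis abs_triangle_ineq4 add_right_mono order_trans real_norm_def)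
  qed
  then have "\<psi> t \<le> 0"
    by (rule tendsto_lowerbound) (auto intro: eventually_mono[OF eventually_le_at_bot] mono)
  then show ?thesis
    by (simp add: \<psi>_def mult_le_0_iff)
qed

text \<open>The squared norm is used because the norm itself may fail to be differentiable where
  \<open>v\<close> vanishes. Young's inequality pays for the linear term with half of the decay, and
  what remains gives \<open>(d\<^sup>2 / c) / c\<close>, the square of the claimed bound.\<close>

lemma bounded_dissipative_norm_le:
  fixes v v' :: "real \<Rightarrow> 'a::real_inner"
  assumes deriv: "\<And>t. (v has_vector_derivative v' t) (at t)"
    and diss: "\<And>t. inner (v' t) (v t) \<le> d * norm (v t) - c * (norm (v t))\<^sup>2"
    and bdd: "bounded (range v)" and c: "c > 0" and d: "d \<ge> 0"
  shows "norm (v t) \<le> d / c"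
proof -
  have D: "((\<lambda>s. (norm (v s))\<^sup>2) has_real_derivative 2 * inner (v' s) (v s)) (at s)" for s
  proof -
    have "((\<lambda>s. inner (v s) (v s)) has_vector_derivative inner (v s) (v' s) + inner (v' s) (v s)) (at s)"
      by (rule bounded_bilinear.has_vector_derivative[OF bounded_bilinear_inner deriv deriv])
    then show ?thesis
      by (simp add: power2_norm_eq_inner has_real_derivative_iff_has_vector_derivative inner_commute)
  qed
  have le: "2 * inner (v' s) (v s) \<le> d\<^sup>2 / c - c * (norm (v s))\<^sup>2" for s
  proof -
    have "0 \<le> (d - c * norm (v s))\<^sup>2 / c" using c by simp
    also have "\<dots> = d\<^sup>2 / c + c * (norm (v s))\<^sup>2 - 2 * d * norm (v s)"
      using c by (simp add: power2_eq_square field_simps)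
    finally show ?thesis using diss[of s] by simp
  qed
  obtain B where "\<And>s. norm (v s) \<le> B" using bdd by (auto simp: bounded_iff)
  then have "\<bar>(norm (v s))\<^sup>2\<bar> \<le> B\<^sup>2" for s by (simp add: power_mono)
  then have "bounded (range (\<lambda>s. (norm (v s))\<^sup>2))" by (auto simp: bounded_iff)
  from bounded_subsolution_le[OF D le this c] have "(norm (v t))\<^sup>2 \<le> (d / c)\<^sup>2"
    by (simp add: power2_eq_square)
  then show ?thesis
    using c d by (auto intro: power2_le_imp_le)
qed

text \<open>Variation of constants with base point -\<infinity>. The improper integral of
  \<open>exp (\<mu> * s) *\<^sub>R g s\<close> up to \<open>t\<close> is expressed as
  \<open>E t - l\<close>, where \<open>E\<close> is an antiderivative and \<open>l\<close> its limit
  along the times \<open>- real n\<close>.\<close>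

lemma bounded_linear_solution:
  fixes g :: "real \<Rightarrow> 'a::banach"
  assumes g: "continuous_on UNIV g" and M: "\<And>t. norm (g t) \<le> M" and \<mu>: "\<mu> > 0"
  obtains w where "\<And>t. (w has_vector_derivative g t - \<mu> *\<^sub>R w t) (at t)"
    and "\<And>t. norm (w t) \<le> M / \<mu>"
proof -
  have "continuous_on UNIV (\<lambda>t. exp (\<mu> * t) *\<^sub>R g t)"
    by (intro continuous_intros g)
  then obtain E where E: "\<And>t. (E has_vector_derivative exp (\<mu> * t) *\<^sub>R g t) (at t)"
    by (rule continuous_has_antiderivative) blast
  \<comment> \<open>Mean value inequality with the scalar majorant
    \<open>M / \<mu> * exp (\<mu> * t)\<close>, whose derivative dominates the norm of the
    derivative of \<open>E\<close>.\<close>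
  have diff: "norm (E b - E a) \<le> M / \<mu> * exp (\<mu> * b) - M / \<mu> * exp (\<mu> * a)" if "a < b" for a b
  proof (rule differentiable_bound_general[OF that])
    show "continuous_on {a..b} E"
      by (intro continuous_at_imp_continuous_on ballI has_vector_derivative_continuous[OF E])
    show "((\<lambda>t. M / \<mu> * exp (\<mu> * t)) has_vector_derivative M * exp (\<mu> * s)) (at s)" for s
      using \<mu> by (auto intro!: derivative_eq_intros simp flip: has_real_derivative_iff_has_vector_derivative)
    show "norm (exp (\<mu> * s) *\<^sub>R g s) \<le> M * exp (\<mu> * s)" for s
      using M[of s] by (simp add: mult.commute)
  qed (intro continuous_intros | rule E)+
  have M0: "M \<ge> 0" by (rule order_trans[OF norm_ge_zero M])
  then have diff': "norm (E b - E a) \<le> M / \<mu> * exp (\<mu> * b)" if "a < b" for a b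
    using diff[OF that] \<mu> by (smt (verit) divide_nonneg_pos exp_ge_zero mult_nonneg_nonneg)
  have lim0: "(\<lambda>n. M / \<mu> * exp (\<mu> * - real n)) \<longlonglongrightarrow> 0"
    by (intro tendsto_mult_right_zero filterlim_compose[OF exp_at_bot]
        filterlim_tendsto_pos_mult_at_bot[OF tendsto_const \<mu>]
        filterlim_compose[OF filterlim_uminus_at_bot_at_top filterlim_real_sequentially])
  have "Cauchy (\<lambda>n. E (- real n))"
  proof (rule CauchyI')
    fix e :: real assume "e > 0"
    then obtain N where N: "\<And>n. n \<ge> N \<Longrightarrow> M / \<mu> * exp (\<mu> * - real n) < e"
      using order_tendstoD(2)[OF lim0] by (auto simp: eventually_sequentially)
    have "norm (E (- real m) - E (- real n)) < e" if "m \<ge> N" "n > m" for m n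
      using diff'[of "- real n" "- real m"] N[of m] that by simp
    then show "\<exists>N. \<forall>m\<ge>N. \<forall>n>m. dist (E (- real m)) (E (- real n)) < e"
      by (auto simp: dist_norm)
  qed
  then obtain l where l: "(\<lambda>n. E (- real n)) \<longlonglongrightarrow> l"
    using Cauchy_convergent convergent_def by blast
  have El: "norm (E t - l) \<le> M / \<mu> * exp (\<mu> * t)" for t
  proof (rule tendsto_upperbound)
    show "(\<lambda>n. norm (E t - E (- real n))) \<longlonglongrightarrow> norm (E t - l)"
      by (intro tendsto_intros l)
    show "\<forall>\<^sub>F n in sequentially. norm (E t - E (- real n)) \<le> M / \<mu> * exp (\<mu> * t)"
      using eventually_gt_at_top[of "nat \<lceil>-t\<rceil>"] by eventually_elim (rule diff', linarith)
  qed simp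
  show thesis
  proof (rule that)
    show "((\<lambda>t. exp (- \<mu> * t) *\<^sub>R (E t - l)) has_vector_derivative
        g t - \<mu> *\<^sub>R exp (- \<mu> * t) *\<^sub>R (E t - l)) (at t)" for t
      by (rule derivative_eq_intros E refl | simp)+ (simp add: flip: exp_add)
    show "norm (exp (- \<mu> * t) *\<^sub>R (E t - l)) \<le> M / \<mu>" for t
    proof -
      have "norm (exp (- \<mu> * t) *\<^sub>R (E t - l)) \<le> exp (- \<mu> * t) * (M / \<mu> * exp (\<mu> * t))"
        using mult_left_mono[OF El[of t], of "exp (- \<mu> * t)"] by simp
      also have "\<dots> = M / \<mu>" by (simp add: exp_minus)
      finally show ?thesis .
    qed
  qed
qed

section \<open>Almost periodic functions\<close>

lemma relatively_dense_mono:
  assumes "relatively_dense X" "X \<subseteq> Y"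
  shows "relatively_dense Y"
proof -
  obtain l where "l > 0" and l: "\<And>a. X \<inter> {a..a + l} \<noteq> {}"
    using assms(1) by (auto simp: relatively_dense_def)
  moreover have "Y \<inter> {a..a + l} \<noteq> {}" for a
    using l[of a] assms(2) by blast
  ultimately show ?thesis unfolding relatively_dense_def by blast
qed

text \<open>An almost period for \<epsilon> = 1 in \<open>{- t..- t + l}\<close> carries
  \<open>t\<close> into the compact interval \<open>{0..l}\<close>, where \<open>f\<close> is
  bounded by continuity; the move costs at most 1.\<close>

lemma almost_periodic_bounded:
  assumes "almost_periodic f"
  shows "bounded (range f)"
proof -
  have "relatively_dense {\<tau>. \<forall>t. norm (f (t + \<tau>) - f t) < 1}"
    using assms by (simp add: almost_periodic_def)
  then obtain l where l: "\<And>a. \<exists>\<tau>. (\<forall>t. norm (f (t + \<tau>) - f t) < 1) \<and> a \<le> \<tau> \<and> \<tau> \<le> a + l"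
    unfolding relatively_dense_def disjoint_iff not_all by auto
  have "compact (f ` {0..l})"
    using assms unfolding almost_periodic_def
    by (intro compact_continuous_image compact_Icc) (meson continuous_on_subset subset_UNIV)
  then have "bounded (f ` {0..l})" by (rule compact_imp_bounded)
  then obtain B where B: "\<And>s. s \<in> {0..l} \<Longrightarrow> norm (f s) \<le> B"
    unfolding bounded_iff by blast
  have "norm (f t) \<le> B + 1" for t
  proof -
    obtain \<tau> where "\<forall>t. norm (f (t + \<tau>) - f t) < 1" and \<tau>': "- t \<le> \<tau>" "\<tau> \<le> - t + l"
      using l[of "- t"] by blast
    then have \<tau>: "norm (f (t + \<tau>) - f t) < 1" by blast
    from \<tau>' have "norm (f (t + \<tau>)) \<le> B" by (intro B) auto
    moreover have "norm (f t) \<le> norm (f (t + \<tau>)) + norm (f (t + \<tau>) - f t)"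
      by (metis norm_minus_commute norm_triangle_sub)
    ultimately show ?thesis using \<tau> by linarith
  qed
  then show ?thesis by (auto simp: bounded_iff)
qed

section \<open>Bounded solutions of strongly dissipative equations in a Hilbert space\<close>

locale dissipative =
  fixes A :: "'a::{real_inner,banach} \<Rightarrow> 'a" and c :: real
  assumes c_pos: "c > 0"
    and diss: "inner (A x - A y) (x - y) \<le> - c * (norm (x - y))\<^sup>2"
begin

text \<open>Subtracting the equations, \<open>diss\<close> yields the quadratic decay and
  Cauchy-Schwarz the linear term in \<open>d\<close>. Besides uniqueness and the transfer of almost
  periods, this estimate gives the contraction property in the existence proof.\<close>

lemma solution_difference_le:
  assumes u: "\<And>t. (u has_vector_derivative A (u t) + f t) (at t)"
    and v: "\<And>t. (v has_vector_derivative A (v t) + g t) (at t)"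
    and bdd: "bounded (range u)" "bounded (range v)"
    and fg: "\<And>t. norm (f t - g t) \<le> d"
  shows "norm (u t - v t) \<le> d / c"
proof (rule bounded_dissipative_norm_le[of "\<lambda>t. u t - v t"])
  show "((\<lambda>t. u t - v t) has_vector_derivative (A (u s) + f s) - (A (v s) + g s)) (at s)" for s
    by (intro has_vector_derivative_diff u v)
  show "inner ((A (u s) + f s) - (A (v s) + g s)) (u s - v s)
      \<le> d * norm (u s - v s) - c * (norm (u s - v s))\<^sup>2" for s
  proof -
    have "inner (f s - g s) (u s - v s) \<le> d * norm (u s - v s)"
      using norm_cauchy_schwarz[of "f s - g s" "u s - v s"] mult_right_mono[OF fg[of s] norm_ge_zero[of "u s - v s"]]
      by linarith
    moreover have "inner ((A (u s) + f s) - (A (v s) + g s)) (u s - v s)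
        = inner (A (u s) - A (v s)) (u s - v s) + inner (f s - g s) (u s - v s)"
      by (simp add: algebra_simps inner_add_left inner_diff_left)
    ultimately show ?thesis using diss[of "u s" "v s"] by linarith
  qed
  show "bounded (range (\<lambda>t. u t - v t))"
    by (rule bounded_minus_comp[OF bdd])
  show "d \<ge> 0" by (rule order_trans[OF norm_ge_zero fg])
qed (rule c_pos)

text \<open>For \<open>\<mu> = L\<^sup>2 / c\<close> the map \<open>x \<mapsto> x + A x / \<mu>\<close> contracts with the factor below wherever \<open>A\<close> is
  \<open>L\<close>-Lipschitz. This is what makes a fixed point argument in the space of bounded continuous
  functions on all of \<open>\<real>\<close> possible, without solving any initial value problem.\<close>

lemma forward_step_contraction:
  assumes lip: "norm (A x - A y) \<le> L * norm (x - y)" and L: "L > 0" "c \<le> L"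
  defines "\<mu> \<equiv> L\<^sup>2 / c"
  shows "norm ((\<mu> *\<^sub>R x + A x) - (\<mu> *\<^sub>R y + A y)) \<le> \<mu> * sqrt (1 - c\<^sup>2 / L\<^sup>2) * norm (x - y)"
proof -
  define N where "N = norm (x - y)"
  have \<mu>: "\<mu> > 0" using L c_pos by (simp add: \<mu>_def)
  have k: "0 \<le> 1 - c\<^sup>2 / L\<^sup>2" using L c_pos by (simp add: power_mono)
  have "(norm ((\<mu> *\<^sub>R x + A x) - (\<mu> *\<^sub>R y + A y)))\<^sup>2 = (norm (\<mu> *\<^sub>R (x - y) + (A x - A y)))\<^sup>2"
    by (simp add: algebra_simps)
  also have "\<dots> = \<mu>\<^sup>2 * N\<^sup>2 + 2 * \<mu> * inner (A x - A y) (x - y) + (norm (A x - A y))\<^sup>2"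
    by (simp add: N_def power2_norm_eq_inner inner_add_left inner_add_right inner_commute power2_eq_square[of \<mu>])
  \<comment> \<open>Dissipativity bounds the cross term, the Lipschitz condition the last one. The
    result is \<open>\<mu>\<^sup>2 * N\<^sup>2\<close> times 1 - 2c/\<mu> +
    \<open>L\<^sup>2 / \<mu>\<^sup>2\<close>, and this factor is smallest, namely
    \<open>1 - c\<^sup>2 / L\<^sup>2\<close>, at \<open>\<mu> = L\<^sup>2 / c\<close>.\<close>
  also have "\<dots> \<le> \<mu>\<^sup>2 * N\<^sup>2 + 2 * \<mu> * (- c * N\<^sup>2) + (L * N)\<^sup>2"
    using \<mu> diss[of x y] lip by (intro add_mono mult_left_mono power_mono) (auto simp: N_def)
  also have "\<dots> = (\<mu> * sqrt (1 - c\<^sup>2 / L\<^sup>2) * N)\<^sup>2"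
    unfolding power_mult_distrib real_sqrt_pow2[OF k] using L c_pos
    by (simp add: \<mu>_def field_simps power2_eq_square)
  finally show ?thesis
    using \<mu> k by (auto simp: N_def intro: power2_le_imp_le)
qed

text \<open>Banach's theorem in a closed ball of the complete space of bounded continuous functions.
  Since \<open>A\<close> is Lipschitz only on bounded sets, the radius \<open>R\<close> is fixed
  first; \<open>L\<close>, \<open>\<mu>\<close> and \<open>k\<close> depend on it.\<close>

lemma bounded_solution_exists:
  assumes lip: "lipschitz_on_bounded_sets A"
    and f: "continuous_on UNIV f" "bounded (range f)"
  obtains u where "\<And>t. (u has_vector_derivative A (u t) + f t) (at t)" "bounded (range u)"
proof -
  obtain B where B: "\<And>t. norm (f t) \<le> B" using f(2) by (auto simp: bounded_iff)
  define M where "M = norm (A 0) + B"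
  have M: "norm (A 0 + f t) \<le> M" for t
    using B[of t] norm_triangle_ineq[of "A 0" "f t"] by (simp add: M_def)
  have M0: "M \<ge> 0" by (rule order_trans[OF norm_ge_zero M])
  \<comment> \<open>Twice the a priori bound \<open>M / c\<close> that comes from comparison with
    the zero function. The factor 2 is the slack that \<open>k_le\<close> needs, whatever the value
    of \<open>L\<close>.\<close>
  define R where "R = 2 * M / c"
  have R: "R \<ge> 0" using M0 c_pos by (simp add: R_def)
  obtain L0 where L0: "L0-lipschitz_on (cball 0 R) A"
    using lip unfolding lipschitz_on_bounded_sets_def by (meson bounded_cball)
  \<comment> \<open>Enlarging \<open>L0\<close> by \<open>c\<close> secures \<open>L > 0\<close>
    even when \<open>L0 = 0\<close>, and \<open>c \<le> L\<close>, which keeps the radicand in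
    \<open>k\<close> nonnegative.\<close>
  define L where "L = L0 + c"
  have L: "L > 0" "c \<le> L" and L0L: "L0 \<le> L"
    using lipschitz_on_nonneg[OF L0] c_pos by (auto simp: L_def)
  have lipL: "norm (A x - A y) \<le> L * norm (x - y)" if "norm x \<le> R" "norm y \<le> R" for x y
    using lipschitz_onD[OF L0, of x y] mult_right_mono[OF L0L norm_ge_zero[of "x - y"]] that
    by (simp add: dist_norm)
  define \<mu> where "\<mu> = L\<^sup>2 / c"
  define k where "k = sqrt (1 - c\<^sup>2 / L\<^sup>2)"
  have \<mu>: "\<mu> > 0" using L c_pos by (simp add: \<mu>_def)
  have q: "0 \<le> 1 - c\<^sup>2 / L\<^sup>2" "1 - c\<^sup>2 / L\<^sup>2 < 1" using L c_pos by (auto simp: power_mono)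
  then have k: "0 \<le> k" "k < 1" by (auto simp: k_def)
  define G where "G x = \<mu> *\<^sub>R x + A x" for x
  have G: "norm (G x - G y) \<le> \<mu> * k * norm (x - y)" if "norm x \<le> R" "norm y \<le> R" for x y
    using forward_step_contraction[OF lipL[OF that] L] by (simp add: G_def \<mu>_def k_def)
  \<comment> \<open>Invariance of the ball. By \<open>sqrt (1 - r) \<le> 1 - r / 2\<close>, the gap
    \<open>\<mu> * (1 - k)\<close> is at least \<open>c / 2\<close>, and
    \<open>c / 2 * R = M\<close>.\<close>
  have k_le: "\<mu> * k * R + M \<le> \<mu> * R"
  proof -
    have "sqrt (1 - r) \<le> 1 - r / 2" if "r \<le> 1" for r :: real
      using that zero_le_power2[of r]
      by (intro real_le_lsqrt) (auto simp: power2_eq_square algebra_simps)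
    then have "k \<le> 1 - c\<^sup>2 / L\<^sup>2 / 2"
      unfolding k_def using q(1) by (metis diff_ge_0_iff_ge)
    then have "\<mu> * k * R + M \<le> \<mu> * (1 - c\<^sup>2 / L\<^sup>2 / 2) * R + M"
      using \<mu> R by (intro add_right_mono mult_right_mono mult_left_mono) auto
    also have "\<dots> = \<mu> * R"
      using L c_pos by (simp add: \<mu>_def R_def field_simps power2_eq_square)
    finally show ?thesis .
  qed
  let ?S = "cball 0 R :: (real \<Rightarrow>\<^sub>C 'a) set"
  have S: "norm (apply_bcontfun u t) \<le> R" if "u \<in> ?S" for u t
    using norm_bounded[of u t] that by simp
  have "\<exists>w\<in>?S. \<forall>t. (w has_vector_derivative G (u t) + f t - \<mu> *\<^sub>R w t) (at t)" if u: "u \<in> ?S" for u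
  proof -
    have "continuous_on (cball 0 R) G"
      unfolding G_def by (intro continuous_intros lipschitz_on_continuous_on[OF L0])
    then have "continuous_on UNIV (\<lambda>t. G (u t))"
      by (rule continuous_on_compose2[OF _ continuous_on_apply_bcontfun]) (use S[OF u] in auto)
    then have "continuous_on UNIV (\<lambda>t. G (u t) + f t)"
      by (rule continuous_on_add[OF _ f(1)])
    moreover have "norm (G (u t) + f t) \<le> \<mu> * R" for t
    proof -
      have "norm (G (u t) - G 0) \<le> \<mu> * k * norm (u t - 0)"
        by (rule G) (use S[OF u] R in auto)
      also have "\<dots> \<le> \<mu> * k * R"
        using S[OF u] \<mu> k by (intro mult_left_mono) auto
      finally have "norm (G (u t) - G 0) \<le> \<mu> * k * R" .
      \<comment> \<open>The splitting uses \<open>G 0 = A 0\<close>.\<close>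
      moreover have "norm (G (u t) + f t) \<le> norm (G (u t) - G 0) + norm (A 0 + f t)"
        using norm_triangle_ineq[of "G (u t) - G 0" "A 0 + f t"] by (simp add: G_def)
      ultimately show ?thesis
        using k_le M[of t] by linarith
    qed
    ultimately obtain w where w: "\<And>t. (w has_vector_derivative G (u t) + f t - \<mu> *\<^sub>R w t) (at t)"
      and w_le: "\<And>t. norm (w t) \<le> \<mu> * R / \<mu>"
      using bounded_linear_solution[OF _ _ \<mu>] by blast
    have "continuous_on UNIV w"
      by (intro continuous_at_imp_continuous_on ballI has_vector_derivative_continuous[OF w])
    then have "w \<in> bcontfun" using w_le by (rule bcontfun_normI)
    then obtain w' where w': "w = apply_bcontfun w'" by (rule bcontfunE)
    have "w' \<in> ?S"
      using w_le \<mu> by (auto simp: w' intro: norm_bound)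
    with w show ?thesis unfolding w' by blast
  qed
  then obtain T where TS: "\<And>u. u \<in> ?S \<Longrightarrow> T u \<in> ?S"
    and T: "\<And>u t. u \<in> ?S \<Longrightarrow> (T u has_vector_derivative G (u t) + f t - \<mu> *\<^sub>R T u t) (at t)"
    by metis
  \<comment> \<open>The equation for \<open>T u\<close> is itself dissipative, with constant
    \<open>\<mu>\<close> and forcing \<open>G (u t) + f t\<close>. The comparison estimate therefore
    divides the Lipschitz constant \<open>\<mu> * k\<close> of \<open>G\<close> by
    \<open>\<mu>\<close>, leaving \<open>k < 1\<close>.\<close>
  interpret decay: dissipative "\<lambda>x :: 'a. - \<mu> *\<^sub>R x" \<mu>
    by standard (use \<mu> in \<open>auto simp: power2_norm_eq_inner algebra_simps inner_add_left inner_diff_left\<close>)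
  have "\<exists>!u\<in>?S. T u = u"
  proof (rule Banach_fix)
    show "dist (T u) (T v) \<le> k * dist u v" if uv: "u \<in> ?S" "v \<in> ?S" for u v
    proof (rule dist_bound)
      fix t
      have "norm (T u t - T v t) \<le> \<mu> * k * dist u v / \<mu>"
      proof (rule decay.solution_difference_le)
        show "(T u has_vector_derivative - \<mu> *\<^sub>R T u s + (G (u s) + f s)) (at s)"
          "(T v has_vector_derivative - \<mu> *\<^sub>R T v s + (G (v s) + f s)) (at s)" for s
          using T[OF uv(1), of s] T[OF uv(2), of s] by simp_all
        show "bounded (range (T u))" "bounded (range (T v))"
          by (auto simp: bounded_iff intro: norm_bounded)
        show "norm (G (u s) + f s - (G (v s) + f s)) \<le> \<mu> * k * dist u v" for s
        proof -
          have "norm (G (u s) - G (v s)) \<le> \<mu> * k * dist (u s) (v s)"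
            using G[OF S[OF uv(1)] S[OF uv(2)]] by (simp add: dist_norm)
          also have "\<dots> \<le> \<mu> * k * dist u v"
            using \<mu> k by (intro mult_left_mono dist_bounded) auto
          finally show ?thesis by simp
        qed
      qed
      then show "dist (T u t) (T v t) \<le> k * dist u v" using \<mu> by (simp add: dist_norm)
    qed
  qed (use k R TS in \<open>auto simp: complete_eq_closed\<close>)
  then obtain u where u: "u \<in> ?S" "T u = u" by blast
  show thesis
  proof (rule that)
    \<comment> \<open>At the fixed point the two terms with \<open>\<mu>\<close> cancel.\<close>
    show "(apply_bcontfun u has_vector_derivative A (u t) + f t) (at t)" for t
      using T[OF u(1), of t] by (simp add: u(2) G_def)
    show "bounded (range (apply_bcontfun u))"
      by (auto simp: bounded_iff intro: norm_bounded)
  qed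
qed

lemma bounded_solution_almost_periodic:
  assumes u: "\<And>t. (u has_vector_derivative A (u t) + f t) (at t)"
    and bdd: "bounded (range u)" and f: "almost_periodic f"
  shows "almost_periodic u"
  unfolding almost_periodic_def
proof (intro conjI allI impI)
  show "continuous_on UNIV u"
    by (intro continuous_at_imp_continuous_on ballI has_vector_derivative_continuous[OF u])
  fix \<epsilon> :: real assume \<epsilon>: "\<epsilon> > 0"
  \<comment> \<open>The comparison estimate is not strict; halving makes \<open>d / c\<close>
    strictly less than \<open>\<epsilon>\<close>.\<close>
  define d where "d = c * \<epsilon> / 2"
  have d: "d > 0" "d / c < \<epsilon>" using \<epsilon> c_pos by (auto simp: d_def)
  have sub: "{\<tau>. \<forall>t. norm (f (t + \<tau>) - f t) < d} \<subseteq> {\<tau>. \<forall>t. norm (u (t + \<tau>) - u t) < \<epsilon>}"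
  proof safe
    fix \<tau> t assume \<tau>: "\<forall>t. norm (f (t + \<tau>) - f t) < d"
    have "norm (u (t + \<tau>) - u t) \<le> d / c"
    \<comment> \<open>As \<open>A\<close> does not depend on time, the translate of \<open>u\<close>
      by \<open>\<tau>\<close> is a bounded solution for the translated forcing.\<close>
    proof (rule solution_difference_le[OF _ u _ bdd])
      show "((\<lambda>t. u (t + \<tau>)) has_vector_derivative A (u (s + \<tau>)) + f (s + \<tau>)) (at s)" for s
        using vector_diff_chain_at[of "\<lambda>t. t + \<tau>" 1 s u "A (u (s + \<tau>)) + f (s + \<tau>)"] u[of "s + \<tau>"]
        by (simp add: o_def has_vector_derivative_add_const)
      show "bounded (range (\<lambda>t. u (t + \<tau>)))"
        by (rule bounded_subset[OF bdd]) auto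
    qed (use \<tau> in \<open>simp add: less_imp_le\<close>)
    then show "norm (u (t + \<tau>) - u t) < \<epsilon>" using d by linarith
  qed
  have "relatively_dense {\<tau>. \<forall>t. norm (f (t + \<tau>) - f t) < d}"
    using f d by (simp add: almost_periodic_def)
  then show "relatively_dense {\<tau>. \<forall>t. norm (u (t + \<tau>) - u t) < \<epsilon>}"
    by (rule relatively_dense_mono[OF _ sub])
qed

theorem ex1_almost_periodic_solution:
  assumes lip: "lipschitz_on_bounded_sets A" and f: "almost_periodic f"
  shows "\<exists>!u. almost_periodic u \<and> (\<forall>t. (u has_vector_derivative A (u t) + f t) (at t))"
proof -
  have "continuous_on UNIV f" using f by (simp add: almost_periodic_def)
  then obtain u where u: "\<And>t. (u has_vector_derivative A (u t) + f t) (at t)" "bounded (range u)"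
    using bounded_solution_exists[OF lip _ almost_periodic_bounded[OF f]] by blast
  show ?thesis
  proof (rule ex1I)
    show "almost_periodic u \<and> (\<forall>t. (u has_vector_derivative A (u t) + f t) (at t))"
      using bounded_solution_almost_periodic[OF u f] u(1) by blast
    fix v assume v: "almost_periodic v \<and> (\<forall>t. (v has_vector_derivative A (v t) + f t) (at t))"
    \<comment> \<open>Every almost periodic solution is bounded, so it can be compared with
      \<open>u\<close> at \<open>d = 0\<close>.\<close>
    then have "bounded (range v)" by (simp add: almost_periodic_bounded)
    have "norm (v t - u t) \<le> 0 / c" for t
      by (rule solution_difference_le[OF _ u(1) \<open>bounded (range v)\<close> u(2)]) (use v in simp_all)
    then show "v = u" by (simp add: fun_eq_iff)
  qed
qed

end

section \<open>The discrete Laplacian and the Nemytskii operator on \<open>l2\<close>\<close>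

instance l2 :: banach ..

lemma infsum_shift:
  fixes x :: "int \<Rightarrow> real"
  shows "(\<Sum>\<^sub>\<infinity>i. x (i + k)) = (\<Sum>\<^sub>\<infinity>i. x i)"
proof -
  have "bij_betw (\<lambda>i. i + k) UNIV UNIV"
    by (rule bij_betwI[of _ _ _ "\<lambda>i. i - k"]) auto
  from infsum_reindex_bij_betw[OF this] show ?thesis .
qed

lemma l2_norm_le_coordinatewise:
  assumes "\<And>i. \<bar>l2_nth x i\<bar> \<le> c * \<bar>l2_nth y i\<bar>" "c \<ge> 0"
  shows "norm x \<le> c * norm y"
proof -
  have "(norm x)\<^sup>2 \<le> (\<Sum>\<^sub>\<infinity>i. c\<^sup>2 * (l2_nth y i)\<^sup>2)"
    unfolding l2_norm_square
  proof (rule infsum_mono)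
    show "(l2_nth x i)\<^sup>2 \<le> c\<^sup>2 * (l2_nth y i)\<^sup>2" for i
      using power_mono[OF assms(1)[of i], of 2] by (simp add: power_mult_distrib)
  qed (intro l2_nth_square_summable summable_on_cmult_right)+
  also have "\<dots> = (c * norm y)\<^sup>2"
    by (simp add: infsum_cmult_right l2_nth_square_summable l2_norm_square power_mult_distrib)
  finally show ?thesis using assms(2) by (auto intro: power2_le_imp_le)
qed

lemma l2_nth_discrete_laplacian:
  "l2_nth (discrete_laplacian u) i = l2_nth u (i - 1) - 2 * l2_nth u i + l2_nth u (i + 1)"
  by transfer simp

lemma discrete_laplacian_diff:
  "discrete_laplacian (u - v) = discrete_laplacian u - discrete_laplacian v"
  by (rule l2_eqI) (simp add: l2_nth_discrete_laplacian)

lemmas l2_shift_summable = square_summable_shift[OF l2_nth_square_summable]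

text \<open>Both Laplacian estimates majorize a summand by squares of three neighbouring entries. By
  shift invariance each of the three sums is the squared norm, so only the total weight
  counts.\<close>

lemma infsum_l2_neighbours:
  fixes u :: l2 and a b :: real
  defines "s \<equiv> \<lambda>i. a * (l2_nth u (i - 1))\<^sup>2 + b * (l2_nth u i)\<^sup>2 + a * (l2_nth u (i + 1))\<^sup>2"
  shows "s summable_on UNIV" "infsum s UNIV = (2 * a + b) * (norm u)\<^sup>2"
proof -
  have sm: "(\<lambda>i. (l2_nth u (i - 1))\<^sup>2) summable_on UNIV" "(\<lambda>i. (l2_nth u (i + 1))\<^sup>2) summable_on UNIV"
    using l2_shift_summable[of u "-1"] l2_shift_summable[of u 1] by simp_all
  note sm = this l2_nth_square_summable[of u]
  show "s summable_on UNIV"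
    unfolding s_def by (intro summable_on_add summable_on_cmult_right sm)
  have "infsum s UNIV = a * (\<Sum>\<^sub>\<infinity>i. (l2_nth u (i - 1))\<^sup>2) + b * (\<Sum>\<^sub>\<infinity>i. (l2_nth u i)\<^sup>2)
      + a * (\<Sum>\<^sub>\<infinity>i. (l2_nth u (i + 1))\<^sup>2)"
    unfolding s_def by (simp add: infsum_add infsum_cmult_right summable_on_add summable_on_cmult_right sm)
  then show "infsum s UNIV = (2 * a + b) * (norm u)\<^sup>2"
    using infsum_shift[of "\<lambda>i. (l2_nth u i)\<^sup>2" "-1"] infsum_shift[of "\<lambda>i. (l2_nth u i)\<^sup>2" 1]
    by (simp add: l2_norm_square algebra_simps)
qed

text \<open>The products of neighbours are at most half the sum of their squares. This leaves the
  weights 1/2, -1, 1/2, whose total is 0.\<close>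

lemma inner_discrete_laplacian_le_0: "inner (discrete_laplacian u) u \<le> 0"
proof -
  let ?s = "\<lambda>i. 1/2 * (l2_nth u (i - 1))\<^sup>2 + (-1) * (l2_nth u i)\<^sup>2 + 1/2 * (l2_nth u (i + 1))\<^sup>2"
  have "inner (discrete_laplacian u) u \<le> infsum ?s UNIV"
    unfolding inner_l2_def
  proof (rule infsum_mono)
    show "l2_nth (discrete_laplacian u) i * l2_nth u i \<le> ?s i" for i
      using zero_le_power2[of "l2_nth u (i - 1) - l2_nth u i"] zero_le_power2[of "l2_nth u (i + 1) - l2_nth u i"]
      unfolding l2_nth_discrete_laplacian by (simp add: power2_eq_square algebra_simps)
  qed (rule square_summable_mult l2_nth_square_summable infsum_l2_neighbours)+
  then show ?thesis unfolding infsum_l2_neighbours by simp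
qed

text \<open>Cauchy-Schwarz for three terms gives the weights 3, 12, 3 with total 18, and 5 is a
  convenient integer above the square root of 18.\<close>

lemma norm_discrete_laplacian_le: "norm (discrete_laplacian u) \<le> 5 * norm u"
proof (rule power2_le_imp_le)
  let ?s = "\<lambda>i. 3 * (l2_nth u (i - 1))\<^sup>2 + 12 * (l2_nth u i)\<^sup>2 + 3 * (l2_nth u (i + 1))\<^sup>2"
  have "(norm (discrete_laplacian u))\<^sup>2 \<le> infsum ?s UNIV"
    unfolding l2_norm_square
  proof (rule infsum_mono)
    show "(l2_nth (discrete_laplacian u) i)\<^sup>2 \<le> ?s i" for i
    proof -
      have "(a - 2 * b + c)\<^sup>2 \<le> 3 * a\<^sup>2 + 12 * b\<^sup>2 + 3 * c\<^sup>2" for a b c :: real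
        using zero_le_power2[of "a + 2 * b"] zero_le_power2[of "a - c"] zero_le_power2[of "c + 2 * b"]
        by (simp add: power2_eq_square algebra_simps)
      then show ?thesis unfolding l2_nth_discrete_laplacian .
    qed
  qed (rule l2_nth_square_summable infsum_l2_neighbours)+
  then show "(norm (discrete_laplacian u))\<^sup>2 \<le> (5 * norm u)\<^sup>2"
    unfolding infsum_l2_neighbours by (simp add: power_mult_distrib) (smt (verit) zero_le_power2)
qed simp

text \<open>Entries are bounded by the norm, so all entries of all points of a bounded set lie in
  one interval, and a single Lipschitz constant of \<open>F\<close> serves every coordinate.\<close>

lemma nemytskii_lipschitz:
  assumes F: "lipschitz_on_bounded_sets F" "F 0 = 0"
  shows "lipschitz_on_bounded_sets (nemytskii F)"
  unfolding lipschitz_on_bounded_sets_def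
proof (intro allI impI)
  fix X :: "l2 set" assume "bounded X"
  then obtain R where R: "\<And>x. x \<in> X \<Longrightarrow> norm x \<le> R" by (auto simp: bounded_iff)
  obtain L where L: "L-lipschitz_on (cball 0 R) F"
    using F(1) unfolding lipschitz_on_bounded_sets_def by (meson bounded_cball)
  have "L-lipschitz_on X (nemytskii F)"
  proof (rule lipschitz_onI)
    fix x y assume xy: "x \<in> X" "y \<in> X"
    have "norm (nemytskii F x - nemytskii F y) \<le> L * norm (x - y)"
    proof (rule l2_norm_le_coordinatewise)
      fix i
      have "l2_nth x i \<in> cball 0 R" "l2_nth y i \<in> cball 0 R"
        using abs_l2_nth_le_norm[of x i] abs_l2_nth_le_norm[of y i] R[OF xy(1)] R[OF xy(2)] by auto
      from lipschitz_onD[OF L this]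
      show "\<bar>l2_nth (nemytskii F x - nemytskii F y) i\<bar> \<le> L * \<bar>l2_nth (x - y) i\<bar>"
        by (simp add: l2_nth_nemytskii F dist_real_def)
    qed (rule lipschitz_on_nonneg[OF L])
    then show "dist (nemytskii F x) (nemytskii F y) \<le> L * dist x y" by (simp add: dist_norm)
  qed (rule lipschitz_on_nonneg[OF L])
  then show "\<exists>L. L-lipschitz_on X (nemytskii F)" ..
qed

lemma inner_nemytskii_diff_le_0:
  assumes F: "lipschitz_on_bounded_sets F" "F 0 = 0"
    and mono: "\<And>x y. (F x - F y) * (x - y) \<le> 0"
  shows "inner (nemytskii F x - nemytskii F y) (x - y) \<le> 0"
proof -
  have "inner (nemytskii F x - nemytskii F y) (x - y) \<le> (\<Sum>\<^sub>\<infinity>i::int. 0)"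
    unfolding inner_l2_def
    by (rule infsum_mono[OF square_summable_mult[OF l2_nth_square_summable l2_nth_square_summable]])
      (auto simp: l2_nth_nemytskii F mono)
  then show ?thesis by simp
qed

section \<open>The lattice system as a dissipative equation\<close>

theorem corollary5p9:
  fixes \<nu> lam \<alpha> :: real and f :: "real \<Rightarrow> l2" and F :: "real \<Rightarrow> real"
  assumes "\<nu> > 0" and "lam > 0" and "\<alpha> \<ge> 0"
    and "almost_periodic f"
    and "continuous_on UNIV F"
    and "lipschitz_on_bounded_sets F"
    and "F 0 = 0"
    and "\<And>x1 x2. (x1 - x2) * (F x1 - F x2) \<le> - \<alpha> * \<bar>x1 - x2\<bar>\<^sup>2"
  shows "\<exists>!u :: real \<Rightarrow> l2. almost_periodic u \<and>
    (\<forall>t. (u has_vector_derivative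
            (\<nu> *\<^sub>R discrete_laplacian (u t) - lam *\<^sub>R u t + nemytskii F (u t) + f t)) (at t))"
proof -
  let ?A = "\<lambda>x. \<nu> *\<^sub>R discrete_laplacian x - lam *\<^sub>R x + nemytskii F x"
  have mono: "(F x - F y) * (x - y) \<le> 0" for x y
    using assms(8)[of x y] mult_nonneg_nonneg[OF assms(3) zero_le_power2[of "\<bar>x - y\<bar>"]]
    by (simp only: mult.commute mult_minus_left)
  \<comment> \<open>The damping term supplies the constant \<open>lam\<close>; the Laplacian and the
    Nemytskii operator contribute nonpositive amounts.\<close>
  interpret dissipative ?A lam
  proof
    fix x y :: l2
    have "?A x - ?A y = \<nu> *\<^sub>R discrete_laplacian (x - y) - lam *\<^sub>R (x - y) + (nemytskii F x - nemytskii F y)"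
      by (simp add: discrete_laplacian_diff algebra_simps)
    then have "inner (?A x - ?A y) (x - y) = \<nu> * inner (discrete_laplacian (x - y)) (x - y)
        - lam * (norm (x - y))\<^sup>2 + inner (nemytskii F x - nemytskii F y) (x - y)"
      by (simp only: inner_add_left inner_diff_left[of "_ *\<^sub>R _"] inner_scaleR_left power2_norm_eq_inner)
    moreover have "\<nu> * inner (discrete_laplacian (x - y)) (x - y) \<le> 0"
      using assms(1) inner_discrete_laplacian_le_0 by (simp add: mult_le_0_iff)
    ultimately show "inner (?A x - ?A y) (x - y) \<le> - lam * (norm (x - y))\<^sup>2"
      using inner_nemytskii_diff_le_0[OF assms(6,7) mono, of x y] by simp
  qed fact
  have lap: "5-lipschitz_on X discrete_laplacian" for X
    by (rule lipschitz_onI)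
      (simp_all add: dist_norm norm_discrete_laplacian_le flip: discrete_laplacian_diff)
  have "lipschitz_on_bounded_sets ?A"
    unfolding lipschitz_on_bounded_sets_def
  proof (intro allI impI)
    fix X :: "l2 set" assume "bounded X"
    then obtain L where "L-lipschitz_on X (nemytskii F)"
      using nemytskii_lipschitz[OF assms(6,7)] unfolding lipschitz_on_bounded_sets_def by blast
    then have "(\<bar>\<nu>\<bar> * 5 + \<bar>lam\<bar> * 1 + L)-lipschitz_on X ?A"
      by (intro lipschitz_on_add lipschitz_on_diff lipschitz_on_cmult lipschitz_on_id lap)
    then show "\<exists>L. L-lipschitz_on X ?A" ..
  qed
  then show ?thesis by (rule ex1_almost_periodic_solution) fact
qed

end
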